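(* Let $p,q>0$ and let $X_1,X_2,\ldots$ be independent identically distributed real random variables. Assume that $\mathbf E X_1=0$ and $\mathbf E|X_1|^\mu<+\infty$ for some $\mu>0$. Let $$\sigma=\begin{cases}1/\mu+1/2,&\mu\ge2,\\ 1/\mu+1,&0<\mu<2.\end{cases}$$ Then $$\mathbf P\Big(\lim_{N\to+\infty}\frac1{N^\sigma}\sum_{n=1}^N\sqrt{w_{p,q}(n/N)}\,X_n=0\Big)=1.$$
   Context: For $p,q>0$, $$w_{p,q}(x)=\Big(\int_0^1\exp(-s^{-p}(1-s)^{-q})\,ds\Big)^{-1}\exp\big(-x^{-p}(1-x)^{-q}\big)\ (x\in(0,1)),\qquad w_{p,q}(x)=0\ (x\notin(0,1)).$$ *)

theory Defs
  imports "HOL-Probability.Probability"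
begin

text \<open>
  The normalising integral is a Lebesgue integral over the open unit interval, since
  \<open>0 powr (- p) = 0\<close> in HOL makes the integrand meaningless at the endpoints.
\<close>

definition bump_weight :: "real \<Rightarrow> real \<Rightarrow> real \<Rightarrow> real" where
  "bump_weight p q x =
     (if x \<in> {0<..<1}
      then inverse (LINT s:{0<..<1}|lborel. exp (- (s powr (- p) * (1 - s) powr (- q))))
           * exp (- (x powr (- p) * (1 - x) powr (- q)))
      else 0)"

end

theory Submission
  imports Defs "HOL-Real_Asymp.Real_Asymp"
begin

text \<open>
  Write \<open>S\<^sub>n = X\<^sub>1 + \<dots> + X\<^sub>n\<close>. The function \<open>v = sqrt (bump_weight p q)\<close> is
  nonnegative and unimodal with peak at \<open>m = p / (p + q)\<close>, because the derivative of the logarithm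
  of \<open>x powr -p * (1 - x) powr -q\<close> on the unit interval changes sign only there. Hence the samples
  \<open>v (n / N)\<close> have total variation bounded independently of \<open>N\<close>, and summation by parts bounds the
  weighted sum by \<open>4 * v m\<close> times the maximum of \<open>\<bar>S\<^sub>n\<bar>\<close> over \<open>n \<le> N\<close>
  (\<open>abel_bound_unimodal\<close>).

  It remains to see that this maximum is almost surely \<open>o(N powr \<sigma>)\<close>. It is monotone in \<open>N\<close>, so
  powers of two suffice. If \<open>Z\<^sub>k\<close> dominates \<open>\<bar>S\<^sub>n\<bar> ^ r\<close> for all \<open>n \<le> 2 ^ k\<close> and the
  expectations of \<open>Z\<^sub>k / 2 powr (k * r * \<sigma>)\<close> are summable in \<open>k\<close>, then these quotients
  are almost surely summable and in particular tend to \<open>0\<close>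
  (\<open>AE_weighted_sum_tendsto_zero\<close>).

  For \<open>\<mu> < 2\<close> one has \<open>\<sigma> > 1\<close>, and the triangle inequality suffices: take \<open>r = 1\<close> and let \<open>Z\<^sub>k\<close>
  be the sum of the \<open>2 ^ k\<close> first absolute values, whose expectation is of order \<open>2 ^ k\<close>. For
  \<open>\<mu> \<ge> 2\<close> the variance is finite and \<open>2 * \<sigma> = 1 + 2 / \<mu>\<close>. Take \<open>r = 2\<close> and obtain \<open>Z\<^sub>k\<close> by the chaining
  argument of Rademacher and Menshov: every initial segment of a dyadic block is a union of at
  most one subblock from each of its \<open>k + 1\<close> levels, so \<open>S\<^sub>n\<^sup>2\<close> is at most \<open>k + 1\<close> times the sum of the
  squares of all dyadic block sums (\<open>partial_sum_square_le_dyadic_energy\<close>). By orthogonality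
  each level contributes \<open>2 ^ k\<close> variances, so \<open>Z\<^sub>k\<close> has expectation of order
  \<open>(k + 1)\<^sup>2 * 2 ^ k\<close>. The logarithmic loss \<open>(k + 1)\<^sup>2\<close> is harmless against the
  factor \<open>2 powr (- 2 * k / \<mu>)\<close> that is left after division.
\<close>

section \<open>Summation by parts for unimodal weights\<close>

lemma summation_by_parts:
  fixes a x :: "nat \<Rightarrow> real"
  shows "(\<Sum>n=1..N. a n * x n)
       = a N * (\<Sum>i=1..N. x i) - (\<Sum>n<N. (a (Suc n) - a n) * (\<Sum>i=1..n. x i))"
  by (induction N) (simp_all add: algebra_simps)

lemma abel_bound_mono:
  fixes a x :: "nat \<Rightarrow> real"
  assumes "mono a" "0 \<le> a 0" and B: "\<And>n. n \<le> N \<Longrightarrow> \<bar>\<Sum>i=1..n. x i\<bar> \<le> B"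
  shows "\<bar>\<Sum>n=1..N. a n * x n\<bar> \<le> 2 * a N * B"
proof -
  have inc: "0 \<le> a (Suc n) - a n" for n using monoD[OF \<open>mono a\<close>, of n "Suc n"] by simp
  have aN: "0 \<le> a N" using assms(2) monoD[OF \<open>mono a\<close>, of 0 N] by simp
  have B0: "0 \<le> B" using B[of 0] by simp
  have "\<bar>\<Sum>n<N. (a (Suc n) - a n) * (\<Sum>i=1..n. x i)\<bar>
      \<le> (\<Sum>n<N. \<bar>(a (Suc n) - a n) * (\<Sum>i=1..n. x i)\<bar>)" by (rule sum_abs)
  also have "\<dots> \<le> (\<Sum>n<N. (a (Suc n) - a n) * B)"
  proof (rule sum_mono)
    fix n assume "n \<in> {..<N}"
    then show "\<bar>(a (Suc n) - a n) * (\<Sum>i=1..n. x i)\<bar> \<le> (a (Suc n) - a n) * B"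
      using inc[of n] B[of n] by (simp add: abs_mult mult_left_mono)
  qed
  also have "\<dots> = (a N - a 0) * B"
    by (simp add: sum_distrib_right[symmetric] sum_lessThan_telescope)
  also have "\<dots> \<le> a N * B" using assms(2) B0 by (simp add: mult_right_mono)
  finally have 1: "\<bar>\<Sum>n<N. (a (Suc n) - a n) * (\<Sum>i=1..n. x i)\<bar> \<le> a N * B" .
  have 2: "\<bar>a N * (\<Sum>i=1..N. x i)\<bar> \<le> a N * B"
    using aN B[of N] by (simp add: abs_mult mult_left_mono)
  show ?thesis unfolding summation_by_parts using 1 2 by linarith
qed

text \<open>
  A unimodal function is the difference of its increasing part up to the peak and its drop after the
  peak. Both are nondecreasing with values between \<open>0\<close> and the peak value \<open>v m\<close>, so each contributes
  at most \<open>2 * v m * B\<close>.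
\<close>

lemma abel_bound_unimodal:
  fixes v :: "real \<Rightarrow> real" and x :: "nat \<Rightarrow> real"
  assumes up: "\<And>s t. s \<le> t \<Longrightarrow> t \<le> m \<Longrightarrow> v s \<le> v t"
    and down: "\<And>s t. m \<le> s \<Longrightarrow> s \<le> t \<Longrightarrow> v t \<le> v s"
    and nonneg: "\<And>t. 0 \<le> v t"
    and B: "\<And>n. n \<le> N \<Longrightarrow> \<bar>\<Sum>i=1..n. x i\<bar> \<le> B"
  shows "\<bar>\<Sum>n=1..N. v (real n / real N) * x n\<bar> \<le> 4 * v m * B"
proof -
  define v1 where "v1 t = v (min t m)" for t
  define v2 where "v2 t = v m - v (max t m)" for t
  have split: "v t = v1 t - v2 t" for t unfolding v1_def v2_def by (cases "t \<le> m") auto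
  have mono1: "s \<le> t \<Longrightarrow> v1 s \<le> v1 t" for s t unfolding v1_def by (rule up) auto
  have mono2: "s \<le> t \<Longrightarrow> v2 s \<le> v2 t" for s t unfolding v2_def
    using down[of "max s m" "max t m"] by auto
  have grid: "i \<le> j \<Longrightarrow> real i / real N \<le> real j / real N" for i j
    by (simp add: divide_right_mono)
  have B0: "0 \<le> B" using B[of 0] by simp
  have v1b: "v1 t \<le> v m" "0 \<le> v1 t" for t
    unfolding v1_def using up[of "min t m" m] nonneg by auto
  have v2b: "v2 t \<le> v m" "0 \<le> v2 t" for t
    unfolding v2_def using down[of m "max t m"] nonneg by auto
  have "\<bar>\<Sum>n=1..N. v1 (real n / real N) * x n\<bar> \<le> 2 * v1 (real N / real N) * B"
    by (rule abel_bound_mono[where a = "\<lambda>n. v1 (real n / real N)"])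
       (auto intro!: monoI mono1 grid v1b B simp del: One_nat_def)
  moreover have "\<bar>\<Sum>n=1..N. v2 (real n / real N) * x n\<bar> \<le> 2 * v2 (real N / real N) * B"
    by (rule abel_bound_mono[where a = "\<lambda>n. v2 (real n / real N)"])
       (auto intro!: monoI mono2 grid v2b B simp del: One_nat_def)
  moreover have "2 * v1 (real N / real N) * B \<le> 2 * v m * B"
    using v1b B0 by (intro mult_right_mono) auto
  moreover have "2 * v2 (real N / real N) * B \<le> 2 * v m * B"
    using v2b B0 by (intro mult_right_mono) auto
  moreover have "(\<Sum>n=1..N. v (real n / real N) * x n)
      = (\<Sum>n=1..N. v1 (real n / real N) * x n) - (\<Sum>n=1..N. v2 (real n / real N) * x n)"
    by (simp add: split left_diff_distrib sum_subtractf)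
  ultimately show ?thesis by (simp add: mult_ac)
qed

section \<open>Unimodality of the bump weight\<close>

text \<open>
  The exponential of \<open>h r = - p * ln r - q * ln (1 - r)\<close>, whose derivative
  \<open>((p + q) * r - p) / (r * (1 - r))\<close> has the sign of \<open>r - p / (p + q)\<close>.
\<close>

lemma bump_exponent_unimodal:
  fixes p q s t :: real
  assumes "p > 0" "q > 0" "0 < s" "s \<le> t" "t < 1"
  shows "t \<le> p / (p + q) \<Longrightarrow> t powr - p * (1 - t) powr - q \<le> s powr - p * (1 - s) powr - q"
    and "p / (p + q) \<le> s \<Longrightarrow> s powr - p * (1 - s) powr - q \<le> t powr - p * (1 - t) powr - q"
proof -
  define h where "h r = - p * ln r - q * ln (1 - r)" for r :: real
  have exp_h: "r powr - p * (1 - r) powr - q = exp (h r)" if "0 < r" "r < 1" for r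
    using that by (simp add: powr_def h_def exp_add[symmetric])
  have deriv: "(h has_real_derivative (- p / r + q / (1 - r))) (at r)" if "0 < r" "r < 1" for r
    unfolding h_def using that by (auto intro!: derivative_eq_intros)
  have sign: "- p / r + q / (1 - r) = ((p + q) * r - p) / (r * (1 - r))" if "0 < r" "r < 1" for r
    using that by (simp add: field_simps)
  show "t powr - p * (1 - t) powr - q \<le> s powr - p * (1 - s) powr - q" if t: "t \<le> p / (p + q)"
  proof -
    have "h t \<le> h s"
    proof (rule DERIV_nonpos_imp_nonincreasing[OF \<open>s \<le> t\<close>])
      fix r assume r: "s \<le> r" "r \<le> t"
      then have r01: "0 < r" "r < 1" using assms by auto
      have "(p + q) * r \<le> (p + q) * (p / (p + q))"
        using r t assms by (intro mult_left_mono) auto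
      then have "(p + q) * r - p \<le> 0" using assms by simp
      then have "- p / r + q / (1 - r) \<le> 0"
        unfolding sign[OF r01] using r01 by (simp add: divide_nonpos_pos)
      then show "\<exists>y. (h has_real_derivative y) (at r) \<and> y \<le> 0" using deriv[OF r01] by blast
    qed
    then show ?thesis using assms by (simp add: exp_h)
  qed
  show "s powr - p * (1 - s) powr - q \<le> t powr - p * (1 - t) powr - q" if s: "p / (p + q) \<le> s"
  proof -
    have "h s \<le> h t"
    proof (rule DERIV_nonneg_imp_nondecreasing[OF \<open>s \<le> t\<close>])
      fix r assume r: "s \<le> r" "r \<le> t"
      then have r01: "0 < r" "r < 1" using assms by auto
      have "(p + q) * (p / (p + q)) \<le> (p + q) * r"
        using r s assms by (intro mult_left_mono) auto
      then have "0 \<le> (p + q) * r - p" using assms by simp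
      then have "0 \<le> - p / r + q / (1 - r)"
        unfolding sign[OF r01] using r01 by simp
      then show "\<exists>y. (h has_real_derivative y) (at r) \<and> 0 \<le> y" using deriv[OF r01] by blast
    qed
    then show ?thesis using assms by (simp add: exp_h)
  qed
qed

lemma bump_weight_nonneg: "0 \<le> bump_weight p q t"
  unfolding bump_weight_def set_lebesgue_integral_def
  by (auto intro!: mult_nonneg_nonneg Bochner_Integration.integral_nonneg)

lemma bump_weight_unimodal:
  fixes p q s t :: real
  assumes "p > 0" "q > 0" "s \<le> t"
  shows "t \<le> p / (p + q) \<Longrightarrow> bump_weight p q s \<le> bump_weight p q t"
    and "p / (p + q) \<le> s \<Longrightarrow> bump_weight p q t \<le> bump_weight p q s"
proof -
  define c where "c = inverse (LINT s:{0<..<1}|lborel. exp (- (s powr (- p) * (1 - s) powr (- q))))"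
  have w: "bump_weight p q x
      = (if x \<in> {0<..<1} then c * exp (- (x powr (- p) * (1 - x) powr (- q))) else 0)" for x
    unfolding bump_weight_def c_def ..
  have "0 \<le> c"
    unfolding c_def set_lebesgue_integral_def by (auto intro!: Bochner_Integration.integral_nonneg)
  have m: "0 < p / (p + q)" "p / (p + q) < 1" using assms by auto
  show "bump_weight p q s \<le> bump_weight p q t" if t: "t \<le> p / (p + q)"
  proof (cases "0 < s")
    case True
    have "0 < t" "t < 1" "s < 1" using True t m assms(3) by linarith+
    with True show ?thesis
      using bump_exponent_unimodal(1)[of p q s t] assms t \<open>0 \<le> c\<close>
      by (simp add: w mult_left_mono)
  next
    case False
    then have "bump_weight p q s = 0" by (simp add: w)
    then show ?thesis by (simp add: bump_weight_nonneg)
  qed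
  show "bump_weight p q t \<le> bump_weight p q s" if s: "p / (p + q) \<le> s"
  proof (cases "t < 1")
    case True
    have "0 < s" "s < 1" "0 < t" using True s m assms(3) by linarith+
    with True show ?thesis
      using bump_exponent_unimodal(2)[of p q s t] assms s \<open>0 \<le> c\<close>
      by (simp add: w mult_left_mono)
  next
    case False
    then have "bump_weight p q t = 0" by (simp add: w)
    then show ?thesis by (simp add: bump_weight_nonneg)
  qed
qed

section \<open>Dyadic chaining\<close>

text \<open>
  All dyadic subblocks of \<open>{a..<a + 2 ^ k}\<close> contribute the square of their sum. Keeping the block itself
  and not only its proper subblocks makes each block pay for its own square when it occurs as the left half
  of a larger one.
\<close>

primrec dyadic_energy :: "(nat \<Rightarrow> real) \<Rightarrow> nat \<Rightarrow> nat \<Rightarrow> real" where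
  "dyadic_energy x 0 a = (x a)\<^sup>2"
| "dyadic_energy x (Suc k) a =
     (\<Sum>i\<in>{a..<a + 2 ^ Suc k}. x i)\<^sup>2 + dyadic_energy x k a + dyadic_energy x k (a + 2 ^ k)"

lemma dyadic_energy_nonneg: "0 \<le> dyadic_energy x k a"
  by (induction k arbitrary: a) auto

lemma block_square_le_dyadic_energy: "(\<Sum>i\<in>{a..<a + 2 ^ k}. x i)\<^sup>2 \<le> dyadic_energy x k a"
  by (cases k) (auto simp: dyadic_energy_nonneg)

text \<open>
  Cauchy's inequality with the weights \<open>1\<close> and \<open>c\<close>. With \<open>c = k + 1\<close> it makes the constant in the chaining
  bound grow from \<open>k + 1\<close> to \<open>k + 2\<close> at each level, where the symmetric choice \<open>c = 1\<close> would double it.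
\<close>

lemma weighted_square_sum:
  fixes A B c :: real
  assumes "c > 0"
  shows "(A + B)\<^sup>2 \<le> (c + 1) * (A\<^sup>2 + B\<^sup>2 / c)"
proof -
  have "(c + 1) * (A\<^sup>2 + B\<^sup>2 / c) - (A + B)\<^sup>2 = (c * A - B)\<^sup>2 / c"
    using assms by (simp add: field_simps power2_eq_square)
  moreover have "0 \<le> (c * A - B)\<^sup>2 / c" using assms by simp
  ultimately show ?thesis by linarith
qed

text \<open>
  A segment reaching into the right half of the block is the whole left half followed by a
  segment of the right half: the left half is itself a block and costs only its own square, and the
  induction hypothesis controls the remainder.
\<close>

lemma partial_sum_square_le_dyadic_energy:
  assumes "n \<le> 2 ^ k"
  shows "(\<Sum>i\<in>{a..<a + n}. x i)\<^sup>2 \<le> real (k + 1) * dyadic_energy x k a"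
  using assms
proof (induction k arbitrary: a n)
  case 0
  then have "n = 0 \<or> n = 1" by auto
  then show ?case by auto
next
  case (Suc k)
  show ?case
  proof (cases "n \<le> 2 ^ k")
    case True
    have "(\<Sum>i\<in>{a..<a + n}. x i)\<^sup>2 \<le> real (k + 1) * dyadic_energy x k a"
      by (rule Suc.IH[OF True])
    also have "\<dots> \<le> real (Suc k + 1) * dyadic_energy x (Suc k) a"
      using dyadic_energy_nonneg by (intro mult_mono) (auto simp: add_nonneg_nonneg)
    finally show ?thesis .
  next
    case False
    define A where "A = (\<Sum>i\<in>{a..<a + 2 ^ k}. x i)"
    define B where "B = (\<Sum>i\<in>{a + 2 ^ k..<a + 2 ^ k + (n - 2 ^ k)}. x i)"
    have split: "(\<Sum>i\<in>{a..<a + n}. x i) = A + B"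
      using False unfolding A_def B_def by (subst sum.atLeastLessThan_concat) auto
    have "B\<^sup>2 \<le> real (k + 1) * dyadic_energy x k (a + 2 ^ k)"
      unfolding B_def using Suc.prems by (intro Suc.IH) auto
    then have B: "B\<^sup>2 / real (k + 1) \<le> dyadic_energy x k (a + 2 ^ k)"
      by (simp add: divide_le_eq mult.commute)
    have A: "A\<^sup>2 \<le> dyadic_energy x k a"
      unfolding A_def by (rule block_square_le_dyadic_energy)
    have "(A + B)\<^sup>2 \<le> (real (k + 1) + 1) * (A\<^sup>2 + B\<^sup>2 / real (k + 1))"
      by (rule weighted_square_sum) simp
    also have "\<dots> \<le> real (Suc k + 1) * dyadic_energy x (Suc k) a"
    proof -
      have "A\<^sup>2 + B\<^sup>2 / real (k + 1) \<le> dyadic_energy x (Suc k) a"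
        using A B zero_le_power2[of "\<Sum>i\<in>{a..<a + 2 ^ Suc k}. x i"]
        unfolding dyadic_energy.simps by linarith
      then show ?thesis by (simp add: mult_left_mono)
    qed
    finally show ?thesis unfolding split .
  qed
qed

section \<open>From dyadic moment bounds to almost sure convergence\<close>

text \<open>
  Each \<open>N \<ge> 1\<close> lies below a power of two that is at most \<open>2 * N\<close>, so passing from \<open>2 ^ k\<close> to \<open>N\<close> in the
  denominator costs only the constant factor \<open>2 powr (r * \<sigma>)\<close>.
\<close>

lemma tendsto_zero_from_dyadic_bound:
  fixes u b :: "nat \<Rightarrow> real" and \<sigma> :: real
  assumes "0 < r" "0 \<le> \<sigma>"
    and bound: "\<And>k N. N \<le> 2 ^ k \<Longrightarrow> \<bar>u N\<bar> ^ r \<le> b k"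
    and lim: "(\<lambda>k. b k / (2 ^ k) powr (real r * \<sigma>)) \<longlonglongrightarrow> 0"
  shows "(\<lambda>N. 1 / real N powr \<sigma> * u N) \<longlonglongrightarrow> 0"
proof -
  define e where "e = real r * \<sigma>"
  have "0 \<le> e" using assms by (simp add: e_def)
  have "(\<lambda>N. \<bar>1 / real N powr \<sigma> * u N\<bar> ^ r) \<longlonglongrightarrow> 0"
  proof (rule LIMSEQ_I)
    fix \<epsilon> :: real assume "\<epsilon> > 0"
    then have "0 < \<epsilon> / 2 powr e" by simp
    from LIMSEQ_D[OF lim this] obtain K
      where K: "\<And>k. K \<le> k \<Longrightarrow> \<bar>b k / (2 ^ k) powr e\<bar> < \<epsilon> / 2 powr e"
      by (auto simp: e_def)
    have "norm (\<bar>1 / real N powr \<sigma> * u N\<bar> ^ r - 0) < \<epsilon>" if N: "2 ^ K \<le> N" for N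
    proof -
      have "1 \<le> (2::nat) ^ K" by simp
      with N have N1: "1 \<le> N" by linarith
      then obtain k where k: "2 ^ k \<le> N" "N < 2 ^ (k + 1)" using ex_power_ivl1[of 2 N] by auto
      have "(2::nat) ^ K < 2 ^ (k + 1)" using N k by linarith
      then have "K \<le> k + 1" by (meson less_imp_le one_less_numeral_iff power_less_imp_less_exp semiring_norm(76))
      note Kk = K[OF this]
      have "real (2 ^ k) \<le> real N" using k(1) by (rule of_nat_mono)
      then have "(2 ^ (k + 1)) powr e \<le> (2 * real N) powr e"
        using \<open>0 \<le> e\<close> by (intro powr_mono2) auto
      then have pw: "(2 ^ (k + 1)) powr e \<le> 2 powr e * real N powr e" by (simp add: powr_mult)
      have "0 < (2::real) ^ (k + 1)" by simp
      then have pos: "0 < (2 ^ (k + 1) :: real) powr e" by simp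
      have "\<bar>u N\<bar> ^ r \<le> b (k + 1)" using k by (intro bound) auto
      also have "\<dots> < \<epsilon> / 2 powr e * (2 ^ (k + 1)) powr e"
        using Kk pos by (simp add: abs_less_iff divide_less_eq)
      also have "\<dots> \<le> \<epsilon> / 2 powr e * (2 powr e * real N powr e)"
        using pw \<open>\<epsilon> > 0\<close> by (intro mult_left_mono) auto
      also have "\<dots> = \<epsilon> * real N powr e" by simp
      finally have "\<bar>u N\<bar> ^ r < \<epsilon> * real N powr e" .
      moreover have "real N powr e = (real N powr \<sigma>) ^ r"
        using N1 by (simp add: e_def powr_power mult.commute)
      ultimately show ?thesis
        using N1 by (simp add: abs_mult power_mult_distrib power_divide divide_less_eq)
    qed
    then show "\<exists>no. \<forall>n\<ge>no. norm (\<bar>1 / real n powr \<sigma> * u n\<bar> ^ r - 0) < \<epsilon>" by blast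
  qed
  then have "(\<lambda>N. root r (\<bar>1 / real N powr \<sigma> * u N\<bar> ^ r)) \<longlonglongrightarrow> root r 0"
    by (rule tendsto_real_root)
  then have "(\<lambda>N. \<bar>1 / real N powr \<sigma> * u N\<bar>) \<longlonglongrightarrow> 0"
    using \<open>0 < r\<close> by (simp add: real_root_power_cancel)
  then show ?thesis by (rule tendsto_rabs_zero_cancel)
qed

text \<open>
  By monotone convergence the sum of the series of functions is integrable, so the series converges
  almost everywhere and its terms tend to \<open>0\<close>.
\<close>

lemma AE_tendsto_zero_if_summable_integrals:
  fixes f :: "nat \<Rightarrow> 'a \<Rightarrow> real"
  assumes int: "\<And>k. integrable M (f k)" and nonneg: "\<And>k x. 0 \<le> f k x"
    and summable: "summable (\<lambda>k. integral\<^sup>L M (f k))"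
  shows "AE x in M. (\<lambda>k. f k x) \<longlonglongrightarrow> 0"
proof -
  have [measurable]: "f k \<in> borel_measurable M" for k using int by auto
  have "(\<integral>\<^sup>+x. (\<Sum>k. ennreal (f k x)) \<partial>M) = (\<Sum>k. \<integral>\<^sup>+x. ennreal (f k x) \<partial>M)"
    by (rule nn_integral_suminf) measurable
  also have "\<dots> = (\<Sum>k. ennreal (integral\<^sup>L M (f k)))"
    using int nonneg by (intro arg_cong[where f = suminf] ext nn_integral_eq_integral) auto
  also have "\<dots> = ennreal (\<Sum>k. integral\<^sup>L M (f k))"
    using summable nonneg by (intro suminf_ennreal2) (auto intro: Bochner_Integration.integral_nonneg)
  finally have "(\<integral>\<^sup>+x. (\<Sum>k. ennreal (f k x)) \<partial>M) \<noteq> \<infinity>" by simp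
  then have "AE x in M. (\<Sum>k. ennreal (f k x)) \<noteq> \<infinity>" by (intro nn_integral_PInf_AE) auto
  then show ?thesis
  proof eventually_elim
    case (elim x)
    then have "summable (\<lambda>k. f k x)" by (intro summable_suminf_not_top nonneg) auto
    then show ?case by (rule summable_LIMSEQ_zero)
  qed
qed

text \<open>
  Almost surely the summable moment bound forces the normalised \<open>Z k\<close> to \<open>0\<close>, and summation by parts
  passes from the unweighted sums to the weighted ones. It has to be applied to each outcome
  separately, for a fixed \<open>N\<close>, because all weights \<open>v (n / N)\<close> change with \<open>N\<close>; the unweighted sums do not, so a
  single \<open>Z k\<close> can serve all \<open>N \<le> 2 ^ k\<close>. Finite first moments give such a \<open>Z\<close> with \<open>r = 1\<close>, and finite
  variances one with \<open>r = 2\<close>.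
\<close>

lemma AE_weighted_sum_tendsto_zero:
  fixes X :: "nat \<Rightarrow> 'a \<Rightarrow> real" and Z :: "nat \<Rightarrow> 'a \<Rightarrow> real" and v :: "real \<Rightarrow> real"
  assumes v: "\<And>s t. s \<le> t \<Longrightarrow> t \<le> m \<Longrightarrow> v s \<le> v t" "\<And>s t. m \<le> s \<Longrightarrow> s \<le> t \<Longrightarrow> v t \<le> v s"
      "\<And>t. 0 \<le> v t"
    and "0 < r" "0 \<le> \<sigma>"
    and Z_int: "\<And>k. integrable M (Z k)"
    and Z: "\<And>k n \<omega>. n \<le> 2 ^ k \<Longrightarrow> \<bar>\<Sum>i=1..n. X i \<omega>\<bar> ^ r \<le> Z k \<omega>"
    and summable: "summable (\<lambda>k. integral\<^sup>L M (Z k) / (2 ^ k) powr (real r * \<sigma>))"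
  shows "AE \<omega> in M. (\<lambda>N. 1 / real N powr \<sigma> * (\<Sum>n=1..N. v (real n / real N) * X n \<omega>)) \<longlonglongrightarrow> 0"
proof -
  have Z0: "0 \<le> Z k \<omega>" for k \<omega> using order_trans[OF _ Z[of 0 k \<omega>]] by simp
  have "AE \<omega> in M. (\<lambda>k. Z k \<omega> / (2 ^ k) powr (real r * \<sigma>)) \<longlonglongrightarrow> 0"
    using Z_int Z0 summable by (intro AE_tendsto_zero_if_summable_integrals) auto
  then show ?thesis
  proof eventually_elim
    case (elim \<omega>)
    show ?case
    proof (rule tendsto_zero_from_dyadic_bound[OF \<open>0 < r\<close> \<open>0 \<le> \<sigma>\<close>])
      show "(\<lambda>k. (4 * v m) ^ r * Z k \<omega> / (2 ^ k) powr (real r * \<sigma>)) \<longlonglongrightarrow> 0"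
        using tendsto_mult_right_zero[OF elim, of "(4 * v m) ^ r"] by simp
    next
      fix k N :: nat assume N: "N \<le> 2 ^ k"
      have "\<bar>\<Sum>i=1..n. X i \<omega>\<bar> \<le> root r (Z k \<omega>)" if "n \<le> N" for n
      proof -
        have "\<bar>\<Sum>i=1..n. X i \<omega>\<bar> = root r (\<bar>\<Sum>i=1..n. X i \<omega>\<bar> ^ r)"
          using \<open>0 < r\<close> by (simp add: real_root_power_cancel)
        also have "\<dots> \<le> root r (Z k \<omega>)"
          using \<open>0 < r\<close> Z[of n k \<omega>] that N by (intro real_root_le_mono) auto
        finally show ?thesis .
      qed
      then have "\<bar>\<Sum>n=1..N. v (real n / real N) * X n \<omega>\<bar> \<le> 4 * v m * root r (Z k \<omega>)"
        by (intro abel_bound_unimodal[OF v]) auto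
      then have "\<bar>\<Sum>n=1..N. v (real n / real N) * X n \<omega>\<bar> ^ r \<le> (4 * v m * root r (Z k \<omega>)) ^ r"
        by (intro power_mono) auto
      also have "\<dots> = (4 * v m) ^ r * Z k \<omega>"
        using \<open>0 < r\<close> Z0 by (simp add: power_mult_distrib)
      finally show "\<bar>\<Sum>n=1..N. v (real n / real N) * X n \<omega>\<bar> ^ r \<le> (4 * v m) ^ r * Z k \<omega>" .
    qed
  qed
qed

lemma sets_Collect_tendsto_zero:
  fixes f :: "nat \<Rightarrow> 'a \<Rightarrow> real"
  assumes [measurable]: "\<And>n. f n \<in> borel_measurable M"
  shows "{x \<in> space M. (\<lambda>n. f n x) \<longlonglongrightarrow> 0} \<in> sets M"
proof -
  \<comment> \<open>Countably many tolerances suffice, and measurability is closed under countable quantifiers.\<close>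
  have null_iff: "u \<longlonglongrightarrow> 0 \<longleftrightarrow> (\<forall>i. \<exists>N. \<forall>n\<ge>N. \<bar>u n\<bar> < inverse (real (Suc i)))"
    for u :: "nat \<Rightarrow> real"
  proof
    assume u: "u \<longlonglongrightarrow> 0"
    show "\<forall>i. \<exists>N. \<forall>n\<ge>N. \<bar>u n\<bar> < inverse (real (Suc i))"
    proof
      fix i
      have "0 < inverse (real (Suc i))" by simp
      from LIMSEQ_D[OF u this] show "\<exists>N. \<forall>n\<ge>N. \<bar>u n\<bar> < inverse (real (Suc i))"
        by (simp only: diff_zero real_norm_def)
    qed
  next
    assume u: "\<forall>i. \<exists>N. \<forall>n\<ge>N. \<bar>u n\<bar> < inverse (real (Suc i))"
    show "u \<longlonglongrightarrow> 0"
    proof (rule LIMSEQ_I)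
      fix \<epsilon> :: real assume "\<epsilon> > 0"
      then obtain i where i: "inverse (real (Suc i)) < \<epsilon>" using reals_Archimedean by blast
      obtain N where "\<forall>n\<ge>N. \<bar>u n\<bar> < inverse (real (Suc i))" using u by blast
      then have "\<forall>n\<ge>N. norm (u n - 0) < \<epsilon>" using i by (metis diff_zero less_trans real_norm_def)
      then show "\<exists>N. \<forall>n\<ge>N. norm (u n - 0) < \<epsilon>" ..
    qed
  qed
  show ?thesis unfolding null_iff by measurable
qed

section \<open>Second moments of independent centred sums\<close>

lemma (in prob_space) indep_centered_sum_square:
  fixes X :: "'i \<Rightarrow> 'a \<Rightarrow> real"
  assumes "finite I" "indep_vars (\<lambda>_. borel) X I"
    and "\<And>i. i \<in> I \<Longrightarrow> integrable M (X i)" "\<And>i. i \<in> I \<Longrightarrow> expectation (X i) = 0"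
    and "\<And>i. i \<in> I \<Longrightarrow> integrable M (\<lambda>\<omega>. (X i \<omega>)\<^sup>2)"
    and "\<And>i. i \<in> I \<Longrightarrow> expectation (\<lambda>\<omega>. (X i \<omega>)\<^sup>2) = V"
  shows "integrable M (\<lambda>\<omega>. (\<Sum>i\<in>I. X i \<omega>)\<^sup>2)
       \<and> expectation (\<lambda>\<omega>. (\<Sum>i\<in>I. X i \<omega>)\<^sup>2) = real (card I) * V"
  using assms
proof (induction I rule: finite_induct)
  case empty
  then show ?case by simp
next
  case (insert j I)
  let ?S = "\<lambda>\<omega>. \<Sum>i\<in>I. X i \<omega>"
  have IH: "integrable M (\<lambda>\<omega>. (?S \<omega>)\<^sup>2)" "expectation (\<lambda>\<omega>. (?S \<omega>)\<^sup>2) = real (card I) * V"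
    using insert.IH[OF indep_vars_subset[OF insert.prems(1)]] insert.prems(2-) by auto
  have indep: "indep_var borel (X j) borel ?S"
    by (rule indep_vars_sum[OF insert.hyps insert.prems(1)])
  have ints: "integrable M (X j)" "integrable M ?S" using insert.prems(2) by auto
  have cross: "integrable M (\<lambda>\<omega>. X j \<omega> * ?S \<omega>)" "expectation (\<lambda>\<omega>. X j \<omega> * ?S \<omega>) = 0"
    using indep_var_integrable[OF indep ints] indep_var_lebesgue_integral[OF indep ints]
      insert.prems(3)[of j] by auto
  have sq: "integrable M (\<lambda>\<omega>. (X j \<omega>)\<^sup>2)" "expectation (\<lambda>\<omega>. (X j \<omega>)\<^sup>2) = V"
    using insert.prems(4,5) by auto
  have expand: "(\<lambda>\<omega>. (\<Sum>i\<in>insert j I. X i \<omega>)\<^sup>2)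
      = (\<lambda>\<omega>. (X j \<omega>)\<^sup>2 + (?S \<omega>)\<^sup>2 + 2 * (X j \<omega> * ?S \<omega>))"
    using insert.hyps by (simp add: power2_sum algebra_simps)
  show ?case
    unfolding expand using IH cross sq insert.hyps by (simp add: algebra_simps)
qed

text \<open>
  Each of the \<open>k + 1\<close> levels of subblocks partitions the block, and the expected squares of the block
  sums on one level add up to \<open>2 ^ k * V\<close> because the terms are orthogonal.
\<close>

lemma (in prob_space) expectation_dyadic_energy:
  fixes X :: "nat \<Rightarrow> 'a \<Rightarrow> real"
  assumes indep: "indep_vars (\<lambda>_. borel) X {1..}"
    and int: "\<And>i. i \<ge> 1 \<Longrightarrow> integrable M (X i)" "\<And>i. i \<ge> 1 \<Longrightarrow> expectation (X i) = 0"
    and sq: "\<And>i. i \<ge> 1 \<Longrightarrow> integrable M (\<lambda>\<omega>. (X i \<omega>)\<^sup>2)"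
       "\<And>i. i \<ge> 1 \<Longrightarrow> expectation (\<lambda>\<omega>. (X i \<omega>)\<^sup>2) = V"
    and "a \<ge> 1"
  shows "integrable M (\<lambda>\<omega>. dyadic_energy (\<lambda>i. X i \<omega>) k a)
       \<and> expectation (\<lambda>\<omega>. dyadic_energy (\<lambda>i. X i \<omega>) k a) = real (k + 1) * 2 ^ k * V"
  using \<open>a \<ge> 1\<close>
proof (induction k arbitrary: a)
  case 0
  then show ?case using sq by simp
next
  case (Suc k)
  have "integrable M (\<lambda>\<omega>. (\<Sum>i\<in>{a..<a + 2 ^ Suc k}. X i \<omega>)\<^sup>2)
      \<and> expectation (\<lambda>\<omega>. (\<Sum>i\<in>{a..<a + 2 ^ Suc k}. X i \<omega>)\<^sup>2)
        = real (card {a..<a + 2 ^ Suc k}) * V"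
    using Suc.prems int sq
    by (intro indep_centered_sum_square indep_vars_subset[OF indep]) auto
  moreover have "1 \<le> a + 2 ^ k" using Suc.prems by simp
  ultimately show ?case
    using Suc.IH[OF Suc.prems] Suc.IH[of "a + 2 ^ k"] by (simp add: algebra_simps)
qed

lemma summable_square_times_geometric:
  fixes \<delta> :: real
  assumes "\<delta> > 0"
  shows "summable (\<lambda>k. real (k + 1) ^ 2 * 2 powr (- \<delta> * real k))"
proof (rule summable_comparison_test_bigo)
  \<comment> \<open>Half of the exponential decay absorbs the polynomial factor.\<close>
  have "(2 powr (- \<delta> / 2) :: real) < 1" using assms by (simp add: powr_less_one)
  then show "summable (\<lambda>k. norm ((2 powr (- \<delta> / 2)) ^ k :: real))"
    by (simp add: summable_geometric)
  show "(\<lambda>k. real (k + 1) ^ 2 * 2 powr (- \<delta> * real k)) \<in> O(\<lambda>k. (2 powr (- \<delta> / 2)) ^ k)"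
    using assms by real_asymp
qed

section \<open>Weighted sums with bump weights\<close>

theorem theorem1p6:
  fixes M :: "'a measure" and X :: "nat \<Rightarrow> 'a \<Rightarrow> real" and p q \<mu> \<sigma> :: real
  assumes "prob_space M"
    and "p > 0" and "q > 0"
    and "prob_space.indep_vars M (\<lambda>_. borel) X {1..}"
    and "\<And>n. n \<ge> 1 \<Longrightarrow> distr M borel (X n) = distr M borel (X 1)"
    and "integrable M (X 1)" and "prob_space.expectation M (X 1) = 0"
    and "\<mu> > 0" and "integrable M (\<lambda>\<omega>. \<bar>X 1 \<omega>\<bar> powr \<mu>)"
    and "\<sigma> = (if \<mu> \<ge> 2 then 1 / \<mu> + 1 / 2 else 1 / \<mu> + 1)"
  shows "prob_space.prob M {\<omega> \<in> space M.
           (\<lambda>N. 1 / real N powr \<sigma> *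
                 (\<Sum>n = 1..N. sqrt (bump_weight p q (real n / real N)) * X n \<omega>))
             \<longlonglongrightarrow> 0} = 1"
proof -
  interpret prob_space M by fact
  have meas: "X n \<in> borel_measurable M" if "n \<ge> 1" for n
    using assms(4) that unfolding indep_vars_def by auto
  have transfer_int: "integrable M (\<lambda>\<omega>. f (X n \<omega>))" if "n \<ge> 1" "integrable M (\<lambda>\<omega>. f (X 1 \<omega>))"
    and "f \<in> borel_measurable borel" for n and f :: "real \<Rightarrow> real"
    using that assms(5)[OF that(1)] integrable_distr_eq[OF meas[OF that(1)] that(3)]
      integrable_distr_eq[OF meas[of 1] that(3)] by simp
  have transfer_exp: "expectation (\<lambda>\<omega>. f (X n \<omega>)) = expectation (\<lambda>\<omega>. f (X 1 \<omega>))" if "n \<ge> 1"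
    and "f \<in> borel_measurable borel" for n and f :: "real \<Rightarrow> real"
    using assms(5)[OF that(1)] integral_distr[OF meas[OF that(1)] that(2)]
      integral_distr[OF meas[of 1] that(2)] by simp
  have int: "integrable M (X n)" if "n \<ge> 1" for n
    using transfer_int[OF that, of "\<lambda>x. x"] assms(6) by simp
  have centered: "expectation (X n) = 0" if "n \<ge> 1" for n
    using transfer_exp[OF that, of "\<lambda>x. x"] assms(7) by simp
  let ?v = "\<lambda>t. sqrt (bump_weight p q t)"
  let ?m = "p / (p + q)"
  have v: "\<And>s t. s \<le> t \<Longrightarrow> t \<le> ?m \<Longrightarrow> ?v s \<le> ?v t" "\<And>s t. ?m \<le> s \<Longrightarrow> s \<le> t \<Longrightarrow> ?v t \<le> ?v s"
    "\<And>t. 0 \<le> ?v t"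
    using bump_weight_unimodal[OF assms(2,3)] by (auto simp: bump_weight_nonneg)
  have "0 \<le> \<sigma>" using assms(8,10) by auto
  have "AE \<omega> in M. (\<lambda>N. 1 / real N powr \<sigma> * (\<Sum>n=1..N. ?v (real n / real N) * X n \<omega>)) \<longlonglongrightarrow> 0"
  proof (cases "\<mu> \<ge> 2")
    case True
    then have \<sigma>: "\<sigma> = 1 / \<mu> + 1 / 2" using assms(10) by simp
    have "integrable M (\<lambda>\<omega>. 1 + \<bar>X 1 \<omega>\<bar> powr \<mu>)" using assms(9) by simp
    then have sq1: "integrable M (\<lambda>\<omega>. (X 1 \<omega>)\<^sup>2)"
    proof (rule Bochner_Integration.integrable_bound)
      show "(\<lambda>\<omega>. (X 1 \<omega>)\<^sup>2) \<in> borel_measurable M" using meas[of 1] by simp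
      have "y\<^sup>2 \<le> 1 + \<bar>y\<bar> powr \<mu>" for y :: real
      proof (cases "\<bar>y\<bar> \<le> 1")
        case True
        then have "y\<^sup>2 \<le> 1" by (simp add: abs_square_le_1)
        then show ?thesis using powr_ge_zero[of "\<bar>y\<bar>" \<mu>] by linarith
      next
        case False
        then have "\<bar>y\<bar> powr 2 \<le> \<bar>y\<bar> powr \<mu>" using True by (intro powr_mono) auto
        then show ?thesis using False by simp
      qed
      then show "AE \<omega> in M. norm ((X 1 \<omega>)\<^sup>2) \<le> norm (1 + \<bar>X 1 \<omega>\<bar> powr \<mu>)" by simp
    qed
    define V where "V = expectation (\<lambda>\<omega>. (X 1 \<omega>)\<^sup>2)"
    have sq: "integrable M (\<lambda>\<omega>. (X n \<omega>)\<^sup>2)" "expectation (\<lambda>\<omega>. (X n \<omega>)\<^sup>2) = V" if "n \<ge> 1" for n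
      using transfer_int[OF that, of "\<lambda>x. x\<^sup>2"] transfer_exp[OF that, of "\<lambda>x. x\<^sup>2"] sq1
      by (auto simp: V_def)
    \<comment> \<open>Starting at index \<open>1\<close>, the block of length \<open>2 ^ k\<close> has the partial sums \<open>S\<^sub>n\<close> as its initial segments.\<close>
    define Z where "Z k \<omega> = real (k + 1) * dyadic_energy (\<lambda>i. X i \<omega>) k 1" for k \<omega>
    have energy: "integrable M (\<lambda>\<omega>. dyadic_energy (\<lambda>i. X i \<omega>) k 1)
       \<and> expectation (\<lambda>\<omega>. dyadic_energy (\<lambda>i. X i \<omega>) k 1) = real (k + 1) * 2 ^ k * V" for k
      by (rule expectation_dyadic_energy[OF assms(4) int centered sq]) auto
    show ?thesis
    proof (rule AE_weighted_sum_tendsto_zero[OF v pos2 \<open>0 \<le> \<sigma>\<close>, where Z = Z])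
      show "integrable M (Z k)" for k unfolding Z_def using energy by simp
      show "\<bar>\<Sum>i=1..n. X i \<omega>\<bar> ^ 2 \<le> Z k \<omega>" if "n \<le> 2 ^ k" for k n \<omega>
        using partial_sum_square_le_dyadic_energy[OF that, of "\<lambda>i. X i \<omega>" 1]
        by (simp add: Z_def atLeastLessThanSuc_atLeastAtMost)
      have "integral\<^sup>L M (Z k) / (2 ^ k) powr (real 2 * \<sigma>)
          = V * (real (k + 1) ^ 2 * 2 powr (- (2 / \<mu>) * real k))" for k
      proof -
        have mean: "integral\<^sup>L M (Z k) = V * (real (k + 1) ^ 2 * 2 ^ k)"
          unfolding Z_def using energy[of k] by (simp add: power2_eq_square)
        have "(2 ^ k :: real) / (2 ^ k) powr (real 2 * \<sigma>) = 2 powr (- (2 / \<mu>) * real k)"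
          by (simp add: \<sigma> powr_realpow[symmetric] powr_powr powr_diff[symmetric] algebra_simps)
        then show ?thesis unfolding mean times_divide_eq_right[symmetric] by (rule arg_cong)
      qed
      then show "summable (\<lambda>k. integral\<^sup>L M (Z k) / (2 ^ k) powr (real 2 * \<sigma>))"
        using summable_square_times_geometric[of "2 / \<mu>"] \<open>\<mu> > 0\<close> by (simp add: summable_mult)
    qed
  next
    case False
    then have \<sigma>: "\<sigma> = 1 / \<mu> + 1" using assms(10) by simp
    define E where "E = expectation (\<lambda>\<omega>. \<bar>X 1 \<omega>\<bar>)"
    have abs: "integrable M (\<lambda>\<omega>. \<bar>X n \<omega>\<bar>)" "expectation (\<lambda>\<omega>. \<bar>X n \<omega>\<bar>) = E" if "n \<ge> 1" for n
      using int[OF that] transfer_exp[OF that, of abs] by (auto simp: E_def)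
    define Z where "Z k \<omega> = (\<Sum>i=1..2 ^ k. \<bar>X i \<omega>\<bar>)" for k \<omega>
    show ?thesis
    proof (rule AE_weighted_sum_tendsto_zero[OF v zero_less_one \<open>0 \<le> \<sigma>\<close>, where Z = Z])
      show "integrable M (Z k)" for k unfolding Z_def using abs by auto
      show "\<bar>\<Sum>i=1..n. X i \<omega>\<bar> ^ 1 \<le> Z k \<omega>" if "n \<le> 2 ^ k" for k n \<omega>
      proof -
        have "\<bar>\<Sum>i=1..n. X i \<omega>\<bar> \<le> (\<Sum>i=1..n. \<bar>X i \<omega>\<bar>)" by (rule sum_abs)
        also have "\<dots> \<le> Z k \<omega>" unfolding Z_def using that by (intro sum_mono2) auto
        finally show ?thesis by simp
      qed
      have "integral\<^sup>L M (Z k) / (2 ^ k) powr (real 1 * \<sigma>) = E * (2 powr (- 1 / \<mu>)) ^ k" for k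
      proof -
        have mean: "integral\<^sup>L M (Z k) = E * 2 ^ k"
          unfolding Z_def using abs by (subst Bochner_Integration.integral_sum) auto
        have "(2 ^ k :: real) / (2 ^ k) powr (real 1 * \<sigma>) = (2 powr (- 1 / \<mu>)) ^ k"
          by (simp add: \<sigma> powr_realpow[symmetric] powr_powr powr_diff[symmetric] algebra_simps)
        then show ?thesis unfolding mean times_divide_eq_right[symmetric] by (rule arg_cong)
      qed
      moreover have "(2 powr (- 1 / \<mu>) :: real) < 1" using \<open>\<mu> > 0\<close> by (simp add: powr_less_one)
      ultimately show "summable (\<lambda>k. integral\<^sup>L M (Z k) / (2 ^ k) powr (real 1 * \<sigma>))"
        by (simp add: summable_mult summable_geometric)
    qed
  qed
  moreover have "{\<omega> \<in> space M. (\<lambda>N. 1 / real N powr \<sigma> *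
      (\<Sum>n=1..N. ?v (real n / real N) * X n \<omega>)) \<longlonglongrightarrow> 0} \<in> events"
    using meas by (intro sets_Collect_tendsto_zero borel_measurable_times borel_measurable_sum) auto
  ultimately show ?thesis by (simp only: prob_Collect_eq_1)
qed

end
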